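(* Let $d\ge 2$ be odd and let $F_1,\dots,F_d$ all be the uniform distribution on $[a,b]$ with $a<0<b$. Let $U\sim U[0,1]$, let $V\sim U[0,1]$ be independent of $U$, and let $J=\mathbf{1}_{V>1/2}$. (1) Let $|a|<b$ and $c=\frac{-2a}{b-a}$. Then $M$ is attained by the random vector $(X_1,\dots,X_d)$ with $X_i=F_i^{-1}(U_i)$, where $$\begin{aligned}U_1&=U_2=\cdots=U_{d-2}=U,\\ U_{d-1}&=(1-I)[KJU+K(1-J)(c-U)+(1-K)JU+(1-K)(1-J)(c-U)]+IU,\\ U_d&=(1-I)[KJU+K(1-J)(c-U)+(1-K)J(c-U)+(1-K)(1-J)U]+IU,\end{aligned}$$ with $I=\mathbf{1}_{U>c}$ and $K=\mathbf{1}_{U>c/2}$. (2) Let $|a|>b$ and $c=\frac{-b-a}{b-a}$. Then $m$ is attained by the random vector $(X_1,\dots,X_d)$ with $X_i=F_i^{-1}(U_i)$, where $$\begin{aligned}U_1&=U_2=\cdots=U_{d-2}=U,\\ U_{d-1}&=(1-I)[KJU+K(1-J)(1+c-U)+(1-K)JU+(1-K)(1-J)(1+c-U)]+IU,\\ U_d&=(1-I)[KJ(1+c-U)+K(1-J)U+(1-K)JU+(1-K)(1-J)(1+c-U)]+IU,\end{aligned}$$ with $I=\mathbf{1}_{U<c}$ and $K=\mathbf{1}_{U>(1+c)/2}$.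
   Context: $X\sim F$ means that $X$ has distribution function $F$, and $F^{-1}$ is the quantile function of $F$. Define $M=\sup \mathbb{E}(X_1X_2\cdots X_d)$ and $m=\inf \mathbb{E}(X_1X_2\cdots X_d)$, where the supremum and infimum are over all random vectors $(X_1,\dots,X_d)$ with $X_i\sim F_i$ for all $i$ and arbitrary dependence. A vector $(X_1,\dots,X_d)$ attains $M$ (resp. $m$) if $X_i\sim F_i$ for all $i$ and $\mathbb{E}(X_1\cdots X_d)$ equals $M$ (resp. $m$). *)

theory Defs
  imports "HOL-Probability.Probability"
begin

definition has_cdf :: "'w measure \<Rightarrow> ('w \<Rightarrow> real) \<Rightarrow> (real \<Rightarrow> real) \<Rightarrow> bool" where
  "has_cdf P X F \<longleftrightarrow> X \<in> borel_measurable P \<and> cdf (distr P borel X) = F"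

definition uniform_cdf :: "real \<Rightarrow> real \<Rightarrow> real \<Rightarrow> real" where
  "uniform_cdf a b = cdf (uniform_measure lborel {a..b})"

text \<open>
  The left-continuous generalised inverse. Its value at levels outside \<open>0 < u < 1\<close> is
  immaterial (possibly an infimum over an unbounded or empty set): such levels are used
  with probability zero only.
\<close>

definition quantile :: "(real \<Rightarrow> real) \<Rightarrow> real \<Rightarrow> real" where
  "quantile F u = Inf {x. u \<le> F x}"

text \<open>
  Random vectors \<open>(X 1, \<dots>, X d)\<close> on the probability space \<open>P\<close> with \<open>X i \<sim> F i\<close> and
  arbitrary dependence, for which the expectation of the product exists as a real number.
  Integrability is automatic if the marginals have bounded support; for other marginals it
  keeps the default value \<open>0\<close> of the Bochner integral out of the supremum and infimum below.
\<close>

definition vector_with_marginals ::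
    "'w measure \<Rightarrow> nat \<Rightarrow> (nat \<Rightarrow> real \<Rightarrow> real) \<Rightarrow> (nat \<Rightarrow> 'w \<Rightarrow> real) \<Rightarrow> bool" where
  "vector_with_marginals P d F X \<longleftrightarrow>
     prob_space P \<and> (\<forall>i\<in>{1..d}. has_cdf P (X i) (F i)) \<and>
     integrable P (\<lambda>\<omega>. \<Prod>i\<in>{1..d}. X i \<omega>)"

text \<open>
  The random vectors range over all probability spaces whose points have type
  \<open>nat \<Rightarrow> real\<close>. Every joint law of \<open>d\<close> real random variables is realised on such a space,
  so other sample spaces contribute no further values; this is
  \<open>product_expectation_in_product_expectations\<close> below.
\<close>

definition product_expectations :: "nat \<Rightarrow> (nat \<Rightarrow> real \<Rightarrow> real) \<Rightarrow> real set" where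
  "product_expectations d F =
     {(\<integral>\<omega>. (\<Prod>i\<in>{1..d}. X i \<omega>) \<partial>Q) | (Q :: (nat \<Rightarrow> real) measure) X.
        vector_with_marginals Q d F X}"

definition sup_product_expectation :: "nat \<Rightarrow> (nat \<Rightarrow> real \<Rightarrow> real) \<Rightarrow> ereal" where
  "sup_product_expectation d F = (SUP e\<in>product_expectations d F. ereal e)"

definition inf_product_expectation :: "nat \<Rightarrow> (nat \<Rightarrow> real \<Rightarrow> real) \<Rightarrow> ereal" where
  "inf_product_expectation d F = (INF e\<in>product_expectations d F. ereal e)"

definition attains_sup ::
    "'w measure \<Rightarrow> nat \<Rightarrow> (nat \<Rightarrow> real \<Rightarrow> real) \<Rightarrow> (nat \<Rightarrow> 'w \<Rightarrow> real) \<Rightarrow> bool" where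
  "attains_sup P d F X \<longleftrightarrow> vector_with_marginals P d F X \<and>
     ereal (\<integral>\<omega>. (\<Prod>i\<in>{1..d}. X i \<omega>) \<partial>P) = sup_product_expectation d F"

definition attains_inf ::
    "'w measure \<Rightarrow> nat \<Rightarrow> (nat \<Rightarrow> real \<Rightarrow> real) \<Rightarrow> (nat \<Rightarrow> 'w \<Rightarrow> real) \<Rightarrow> bool" where
  "attains_inf P d F X \<longleftrightarrow> vector_with_marginals P d F X \<and>
     ereal (\<integral>\<omega>. (\<Prod>i\<in>{1..d}. X i \<omega>) \<partial>P) = inf_product_expectation d F"

lemma product_expectation_in_product_expectations:
  assumes "vector_with_marginals P d F X"
  shows "(\<integral>\<omega>. (\<Prod>i\<in>{1..d}. X i \<omega>) \<partial>P) \<in> product_expectations d F"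
proof -
  interpret prob_space P
    using assms by (simp add: vector_with_marginals_def)
  define N where "N = (\<Pi>\<^sub>M i\<in>{1..d}. (borel :: real measure))"
  define T where "T = (\<lambda>\<omega>. \<lambda>i\<in>{1..d}. X i \<omega>)"
  define Q where "Q = distr P N T"
  have X: "X i \<in> borel_measurable P" if "i \<in> {1..d}" for i
    using assms that by (simp add: vector_with_marginals_def has_cdf_def)
  have T: "T \<in> measurable P N"
    unfolding T_def N_def using X by (intro measurable_restrict) auto
  have proj: "(\<lambda>x. x i) \<in> measurable N borel" if "i \<in> {1..d}" for i
    using that unfolding N_def by (rule measurable_component_singleton)
  have prod: "(\<lambda>x. \<Prod>i\<in>{1..d}. x i) \<in> borel_measurable N"
    using proj by (intro borel_measurable_prod) auto
  have Tprod: "(\<Prod>i\<in>{1..d}. T \<omega> i) = (\<Prod>i\<in>{1..d}. X i \<omega>)" for \<omega>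
    by (intro prod.cong) (auto simp: T_def)
  have "has_cdf Q (\<lambda>x. x i) (F i)" if i: "i \<in> {1..d}" for i
  proof -
    have "distr Q borel (\<lambda>x. x i) = distr P borel (X i)"
      unfolding Q_def using i
      by (subst distr_distr[OF proj[OF i] T]) (auto intro!: distr_cong simp: T_def)
    then show ?thesis
      using assms i proj[OF i] by (auto simp: vector_with_marginals_def has_cdf_def Q_def)
  qed
  moreover have "prob_space Q"
    unfolding Q_def using T by (rule prob_space_distr)
  moreover have "integrable Q (\<lambda>x. \<Prod>i\<in>{1..d}. x i)"
    using assms unfolding Q_def
    by (subst integrable_distr_eq[OF T prod]) (simp only: Tprod vector_with_marginals_def)
  ultimately have "vector_with_marginals Q d F (\<lambda>i x. x i)"
    by (simp add: vector_with_marginals_def)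
  moreover have "(\<integral>x. (\<Prod>i\<in>{1..d}. x i) \<partial>Q) = (\<integral>\<omega>. (\<Prod>i\<in>{1..d}. X i \<omega>) \<partial>P)"
    unfolding Q_def by (subst integral_distr[OF T prod]) (simp only: Tprod)
  ultimately show ?thesis
    unfolding product_expectations_def mem_Collect_eq
    by (intro exI[of _ Q] exI[of _ "\<lambda>i x. x i"]) simp
qed

end

theory Submission
  imports Defs
begin

text \<open>
  By AM-GM, \<open>\<bar>E (X\<^sub>1 \<dots> X\<^sub>d)\<bar> \<le> E \<bar>X\<^sub>1\<bar> ^ d\<close> for identically distributed \<open>X\<^sub>i\<close>, with equality if
  all \<open>\<bar>X\<^sub>i\<bar>\<close> agree and the product has constant sign. Reflecting the level \<open>U\<close> in \<open>{0..c}\<close>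
  (resp. \<open>{c..1}\<close>) flips the sign of the quantile, and the coin \<open>J\<close> decides which of the last
  two coordinates are flipped so that both stay uniform and, \<open>d\<close> being odd, the product is
  always \<open>\<bar>X\<^sub>1\<bar> ^ d\<close> (resp. \<open>- \<bar>X\<^sub>1\<bar> ^ d\<close>).
\<close>

section \<open>The bound on expectations of products and its equality case\<close>

lemma has_cdf_distr_eq:
  assumes "prob_space P" "has_cdf P X G" "prob_space Q" "has_cdf Q Y G"
  shows "distr P borel X = distr Q borel Y"
proof (rule cdf_unique)
  show "real_distribution (distr P borel X)" "real_distribution (distr Q borel Y)"
    using assms by (auto simp: has_cdf_def intro!: prob_space.real_distribution_distr)
qed (use assms in \<open>simp add: has_cdf_def\<close>)

text \<open>This is AM-GM for the numbers \<open>x i ^ card S\<close>: their geometric mean is the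
  product of the \<open>x i\<close>.\<close>

lemma prod_le_mean_power:
  fixes x :: "'i \<Rightarrow> real"
  assumes "finite S" "S \<noteq> {}" and x: "\<And>i. i \<in> S \<Longrightarrow> 0 \<le> x i"
  shows "(\<Prod>i\<in>S. x i) \<le> (\<Sum>i\<in>S. x i ^ card S) / card S"
proof -
  have n: "card S \<noteq> 0"
    using assms by simp
  have "(\<Prod>i\<in>S. x i ^ card S) powr (1 / card S) \<le> (\<Sum>i\<in>S. x i ^ card S / card S)"
    using assms by (intro arith_geom_mean) auto
  moreover have "(\<Prod>i\<in>S. x i ^ card S) powr (1 / card S) = (\<Prod>i\<in>S. x i)"
  \<comment> \<open>Rewriting a power as \<open>powr\<close> requires a positive base, so a
    vanishing product is treated separately.\<close>
  proof (cases "(\<Prod>i\<in>S. x i) = 0")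
    case False
    then have "0 < (\<Prod>i\<in>S. x i)"
      using x by (metis less_eq_real_def prod_nonneg)
    then have "(\<Prod>i\<in>S. x i ^ card S) = (\<Prod>i\<in>S. x i) powr card S"
      by (simp add: prod_power_distrib powr_realpow)
    then show ?thesis
      using n \<open>0 < (\<Prod>i\<in>S. x i)\<close> by (simp add: powr_powr)
  qed (use n in \<open>simp flip: prod_power_distrib\<close>)
  ultimately show ?thesis
    by (simp add: sum_divide_distrib)
qed

text \<open>AM-GM bounds the product pointwise by the mean of the
  \<open>\<bar>Y i\<bar> ^ d\<close>. These all have the same expectation, since it depends on the
  common law only. \<open>X\<close> is a representative of that law, possibly on another space,
  which names this moment.\<close>

lemma abs_expectation_prod_le:
  assumes Y: "vector_with_marginals Q d F Y" and "0 < d"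
    and F: "\<And>i. i \<in> {1..d} \<Longrightarrow> F i = G"
    and P: "prob_space P" and X: "has_cdf P X G"
    and int: "integrable P (\<lambda>\<omega>. \<bar>X \<omega>\<bar> ^ d)"
  shows "\<bar>\<integral>\<omega>. (\<Prod>i\<in>{1..d}. Y i \<omega>) \<partial>Q\<bar> \<le> (\<integral>\<omega>. \<bar>X \<omega>\<bar> ^ d \<partial>P)"
proof -
  have Xm: "X \<in> borel_measurable P"
    using X by (simp add: has_cdf_def)
  have moment: "integrable Q (\<lambda>\<omega>. \<bar>Y i \<omega>\<bar> ^ d) \<and> (\<integral>\<omega>. \<bar>Y i \<omega>\<bar> ^ d \<partial>Q) = (\<integral>\<omega>. \<bar>X \<omega>\<bar> ^ d \<partial>P)"
    if i: "i \<in> {1..d}" for i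
  proof -
    have Yi: "has_cdf Q (Y i) G"
      using Y i F[OF i] by (auto simp: vector_with_marginals_def)
    then have Ym: "Y i \<in> borel_measurable Q"
      by (simp add: has_cdf_def)
    have eq: "distr P borel X = distr Q borel (Y i)"
      using Y by (intro has_cdf_distr_eq[OF P X _ Yi]) (simp add: vector_with_marginals_def)
    have "integrable (distr P borel X) (\<lambda>x. \<bar>x\<bar> ^ d)"
      using int Xm by (simp add: integrable_distr_eq)
    moreover have "(\<integral>x. \<bar>x\<bar> ^ d \<partial>distr P borel X) = (\<integral>\<omega>. \<bar>X \<omega>\<bar> ^ d \<partial>P)"
      using Xm by (simp add: integral_distr)
    ultimately show ?thesis
      unfolding eq using Ym by (simp add: integrable_distr_eq integral_distr)
  qed
  have "\<bar>\<integral>\<omega>. (\<Prod>i\<in>{1..d}. Y i \<omega>) \<partial>Q\<bar> \<le> (\<integral>\<omega>. \<bar>\<Prod>i\<in>{1..d}. Y i \<omega>\<bar> \<partial>Q)"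
    by (rule integral_abs_bound)
  also have "\<dots> \<le> (\<integral>\<omega>. (\<Sum>i\<in>{1..d}. \<bar>Y i \<omega>\<bar> ^ d) / d \<partial>Q)"
  proof (rule integral_mono)
    show "integrable Q (\<lambda>\<omega>. \<bar>\<Prod>i\<in>{1..d}. Y i \<omega>\<bar>)"
      using Y by (simp add: vector_with_marginals_def)
    show "integrable Q (\<lambda>\<omega>. (\<Sum>i\<in>{1..d}. \<bar>Y i \<omega>\<bar> ^ d) / d)"
      using moment by (intro integrable_divide Bochner_Integration.integrable_sum) blast
    show "\<bar>\<Prod>i\<in>{1..d}. Y i \<omega>\<bar> \<le> (\<Sum>i\<in>{1..d}. \<bar>Y i \<omega>\<bar> ^ d) / d" for \<omega>
      using prod_le_mean_power[of "{1..d}" "\<lambda>i. \<bar>Y i \<omega>\<bar>"] \<open>0 < d\<close> by (simp add: abs_prod)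
  qed
  also have "\<dots> = (\<integral>\<omega>. \<bar>X \<omega>\<bar> ^ d \<partial>P)"
    using moment \<open>0 < d\<close> by (simp add: Bochner_Integration.integral_sum)
  finally show ?thesis .
qed

text \<open>Every admissible expectation lies between minus and plus the \<open>d\<close>-th
  absolute moment, so a vector whose product is almost surely an extreme value attains the
  corresponding bound.\<close>

lemma
  assumes "prob_space P" and "0 < d"
    and F: "\<And>i. i \<in> {1..d} \<Longrightarrow> F i = G"
    and X: "\<And>i. i \<in> {1..d} \<Longrightarrow> has_cdf P (X i) G"
    and int: "integrable P (\<lambda>\<omega>. \<bar>X 1 \<omega>\<bar> ^ d)"
  shows attains_supI_prod_eq_abs_power:
      "(AE \<omega> in P. (\<Prod>i\<in>{1..d}. X i \<omega>) = \<bar>X 1 \<omega>\<bar> ^ d) \<Longrightarrow> attains_sup P d F X" (is "?A \<Longrightarrow> _")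
    and attains_infI_prod_eq_minus_abs_power:
      "(AE \<omega> in P. (\<Prod>i\<in>{1..d}. X i \<omega>) = - (\<bar>X 1 \<omega>\<bar> ^ d)) \<Longrightarrow> attains_inf P d F X" (is "?B \<Longrightarrow> _")
proof -
  let ?m = "\<integral>\<omega>. \<bar>X 1 \<omega>\<bar> ^ d \<partial>P"
  have Xm [measurable]: "X i \<in> borel_measurable P" if "i \<in> {1..d}" for i
    using X[OF that] by (simp add: has_cdf_def)
  have prod_m: "(\<lambda>\<omega>. \<Prod>i\<in>{1..d}. X i \<omega>) \<in> borel_measurable P"
    by (intro borel_measurable_prod Xm)
  have pow_m: "(\<lambda>\<omega>. \<bar>X 1 \<omega>\<bar> ^ d) \<in> borel_measurable P"
    using int by (rule borel_measurable_integrable)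
  have bound: "- ?m \<le> e \<and> e \<le> ?m" if e: "e \<in> product_expectations d F" for e
  proof -
    obtain Q :: "(nat \<Rightarrow> real) measure" and Y where
      Y: "vector_with_marginals Q d F Y" and "e = (\<integral>\<omega>. (\<Prod>i\<in>{1..d}. Y i \<omega>) \<partial>Q)"
      using e unfolding product_expectations_def by blast
    then have "\<bar>e\<bar> \<le> ?m"
      using abs_expectation_prod_le[OF Y \<open>0 < d\<close> F assms(1) X int] \<open>0 < d\<close> by simp
    then show ?thesis
      by linarith
  qed
  show "attains_sup P d F X" if A: ?A
  proof -
    have "integrable P (\<lambda>\<omega>. \<Prod>i\<in>{1..d}. X i \<omega>)"
      using integrable_cong_AE[OF prod_m pow_m A] int by simp
    then have vec: "vector_with_marginals P d F X"
      using assms by (simp add: vector_with_marginals_def)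
    have m: "(\<integral>\<omega>. (\<Prod>i\<in>{1..d}. X i \<omega>) \<partial>P) = ?m"
      by (rule integral_cong_AE[OF prod_m pow_m A])
    have "sup_product_expectation d F = ereal ?m"
      unfolding sup_product_expectation_def
      \<comment> \<open>The supremum ranges over sample spaces of points
        \<open>nat \<Rightarrow> real\<close> only, whereas \<open>P\<close> is arbitrary; the value
        \<open>?m\<close> belongs to the set because the joint law can be transferred.\<close>
      using product_expectation_in_product_expectations[OF vec, unfolded m] bound
      by (intro antisym SUP_least SUP_upper) auto
    then show ?thesis
      unfolding attains_sup_def m using vec by simp
  qed
  show "attains_inf P d F X" if B: ?B
  proof -
    have pow_m': "(\<lambda>\<omega>. - (\<bar>X 1 \<omega>\<bar> ^ d)) \<in> borel_measurable P"
      using pow_m by simp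
    have "integrable P (\<lambda>\<omega>. \<Prod>i\<in>{1..d}. X i \<omega>)"
      using integrable_cong_AE[OF prod_m pow_m' B] int by simp
    then have vec: "vector_with_marginals P d F X"
      using assms by (simp add: vector_with_marginals_def)
    have m: "(\<integral>\<omega>. (\<Prod>i\<in>{1..d}. X i \<omega>) \<partial>P) = - ?m"
      using integral_cong_AE[OF prod_m pow_m' B] by simp
    have "inf_product_expectation d F = ereal (- ?m)"
      unfolding inf_product_expectation_def
      using product_expectation_in_product_expectations[OF vec, unfolded m] bound
      by (intro antisym INF_greatest INF_lower) (auto simp del: uminus_ereal.simps)
    then show ?thesis
      unfolding attains_inf_def m using vec by simp
  qed
qed

section \<open>Uniform distributions and their quantile transform\<close>

lemma uniform_cdf_eq:
  assumes "a < b"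
  shows "uniform_cdf a b x = max 0 (min 1 ((x - a) / (b - a)))"
proof -
  have "{a..b} \<inter> {..x} = {a..min b x}"
    by auto
  then have F: "uniform_cdf a b x = measure lborel {a..min b x} / (b - a)"
    using assms by (simp add: uniform_cdf_def cdf_def)
  consider "x < a" | "a \<le> x" "x \<le> b" | "b < x"
    by linarith
  then show ?thesis
  proof cases
    case 1
    then have "(x - a) / (b - a) \<le> 0"
      using assms by (intro divide_nonpos_pos) simp_all
    then show ?thesis
      using 1 assms by (simp only: F) simp
  next
    case 2
    then have "0 \<le> (x - a) / (b - a)" "(x - a) / (b - a) \<le> 1"
      using assms by simp_all
    then show ?thesis
      using 2 by (simp only: F) simp
  next
    case 3
    then have "1 \<le> (x - a) / (b - a)"
      using assms by simp
    then show ?thesis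
      using 3 assms by (simp only: F) simp
  qed
qed

text \<open>For these levels the superlevel set of the distribution function is a closed half-line,
  and the quantile is its endpoint. At level 0 it would be the whole line.\<close>

lemma quantile_uniform_cdf:
  assumes "a < b" "0 < u" "u \<le> 1"
  shows "quantile (uniform_cdf a b) u = a + (b - a) * u"
proof -
  have "{x. u \<le> uniform_cdf a b x} = {a + (b - a) * u..}"
    using assms by (auto simp: uniform_cdf_eq le_max_iff_disj pos_le_divide_eq algebra_simps)
  then show ?thesis
    by (simp add: quantile_def)
qed

text \<open>Outside \<open>0 < u \<le> 1\<close> the infimum is over \<open>UNIV\<close> or the
  empty set, hence a constant on each side, whatever its value. The quantile function is therefore
  piecewise affine.\<close>

lemma borel_measurable_quantile_uniform_cdf:
  assumes "a < b"
  shows "quantile (uniform_cdf a b) \<in> borel_measurable borel"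
proof -
  have "{x. u \<le> uniform_cdf a b x} = UNIV" if "u \<le> 0" for u
    using assms that by (auto simp: uniform_cdf_eq)
  moreover have "{x. u \<le> uniform_cdf a b x} = {}" if "u > 1" for u
    using assms that by (auto simp: uniform_cdf_eq)
  ultimately have "quantile (uniform_cdf a b) =
      (\<lambda>u. if u \<le> 0 then Inf UNIV else if u > 1 then Inf {} else a + (b - a) * u)"
    using assms quantile_uniform_cdf by (intro ext) (auto simp: quantile_def)
  then show ?thesis
    by simp
qed

lemma distr_uniform:
  assumes "prob_space P" "has_cdf P W (uniform_cdf a b)" "a < b"
  shows "distr P borel W = uniform_measure lborel {a..b}"
proof (rule cdf_unique)
  show "real_distribution (uniform_measure lborel {a..b})"
    using \<open>a < b\<close> by (auto simp: real_distribution_def real_distribution_axioms_def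
      intro!: prob_space_uniform_measure)
  show "real_distribution (distr P borel W)"
    using assms by (auto simp: has_cdf_def intro!: prob_space.real_distribution_distr)
qed (use assms in \<open>simp add: has_cdf_def uniform_cdf_def\<close>)

text \<open>The lower bound is strict so that, for levels, the result places \<open>W\<close> in the
  range where the quantile has its affine form.\<close>

lemma AE_uniform:
  assumes "prob_space P" "has_cdf P W (uniform_cdf a b)" "a < b"
  shows "AE \<omega> in P. a < W \<omega> \<and> W \<omega> \<le> b"
proof -
  have "AE x in distr P borel W. a < x \<and> x \<le> b"
    unfolding distr_uniform[OF assms]
    using AE_lborel_singleton[of a] by (intro AE_uniform_measureI) auto
  then show ?thesis
    using assms(2) by (subst (asm) AE_distr_iff) (auto simp: has_cdf_def)
qed

lemma AE_quantile_uniform: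
  assumes "prob_space P" "has_cdf P W (uniform_cdf 0 1)" "a < b"
  shows "AE \<omega> in P. quantile (uniform_cdf a b) (W \<omega>) = a + (b - a) * W \<omega>"
  using AE_uniform[OF assms(1,2)] by (auto simp: quantile_uniform_cdf assms(3))

lemma has_cdf_quantile_uniform:
  assumes P: "prob_space P" and W: "has_cdf P W (uniform_cdf 0 1)" and ab: "a < b"
  shows "has_cdf P (\<lambda>\<omega>. quantile (uniform_cdf a b) (W \<omega>)) (uniform_cdf a b)"
proof -
  have Wm [measurable]: "W \<in> borel_measurable P"
    using W by (simp add: has_cdf_def)
  have m: "(\<lambda>\<omega>. quantile (uniform_cdf a b) (W \<omega>)) \<in> borel_measurable P"
    by (rule measurable_compose[OF Wm borel_measurable_quantile_uniform_cdf[OF ab]])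
  have "distr P borel (\<lambda>\<omega>. quantile (uniform_cdf a b) (W \<omega>)) = distr P borel (\<lambda>\<omega>. a + (b - a) * W \<omega>)"
    using m by (intro distr_cong_AE AE_quantile_uniform[OF P W ab]) auto
  moreover have "cdf (distr P borel (\<lambda>\<omega>. a + (b - a) * W \<omega>)) x = uniform_cdf a b x" for x
  proof -
    have "(\<lambda>\<omega>. a + (b - a) * W \<omega>) -` {..x} \<inter> space P = W -` {..(x - a) / (b - a)} \<inter> space P"
      using ab by (auto simp: field_simps)
    then have "cdf (distr P borel (\<lambda>\<omega>. a + (b - a) * W \<omega>)) x = cdf (distr P borel W) ((x - a) / (b - a))"
      by (simp add: cdf_def measure_distr)
    also have "\<dots> = uniform_cdf 0 1 ((x - a) / (b - a))"
      using W by (simp add: has_cdf_def)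
    finally show ?thesis
      using ab by (simp add: uniform_cdf_eq)
  qed
  ultimately show ?thesis
    using m by (auto simp: has_cdf_def)
qed

section \<open>Reflection of levels on an interval, and fair mixtures\<close>

definition reflect :: "real \<Rightarrow> real \<Rightarrow> real \<Rightarrow> real" where
  "reflect l h u = (if u \<in> {l..h} then l + h - u else u)"

lemma borel_measurable_reflect [measurable]: "reflect l h \<in> borel_measurable borel"
  unfolding reflect_def by measurable

text \<open>The preimage of \<open>A\<close> consists of the part of \<open>A\<close> outside the
  interval, left in place, and the flipped part inside. The flip \<open>l + h - u\<close> preserves
  Lebesgue measure and maps the interval to itself.\<close>

lemma emeasure_lborel_vimage_reflect:
  assumes [measurable]: "A \<in> sets borel"
  shows "emeasure lborel (reflect l h -` A) = emeasure lborel A"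
proof -
  have flip: "emeasure lborel ((\<lambda>u. l + h - u) -` B) = emeasure lborel B" if "B \<in> sets borel" for B
  proof -
    have "lborel = distr lborel borel (\<lambda>u. l + h - u)"
      using lborel_real_affine[of "-1" "l + h"] by (simp add: density_1 one_ennreal_def[symmetric])
    then have "emeasure lborel B = emeasure (distr lborel borel (\<lambda>u. l + h - u)) B"
      by simp
    then show ?thesis
      using that by (simp add: emeasure_distr)
  qed
  have "reflect l h -` A = (A - {l..h}) \<union> (\<lambda>u. l + h - u) -` (A \<inter> {l..h})"
    by (auto simp: reflect_def split: if_splits)
  moreover have "(\<lambda>u. l + h - u) -` (A \<inter> {l..h}) \<in> sets lborel"
    unfolding sets_lborel by (rule measurable_sets_borel[of _ borel]) auto
  moreover have "(A - {l..h}) \<inter> (\<lambda>u. l + h - u) -` (A \<inter> {l..h}) = {}"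
    by auto
  ultimately have "emeasure lborel (reflect l h -` A) =
      emeasure lborel (A - {l..h}) + emeasure lborel ((\<lambda>u. l + h - u) -` (A \<inter> {l..h}))"
    by (simp add: plus_emeasure)
  also have "\<dots> = emeasure lborel ((A - {l..h}) \<union> (A \<inter> {l..h}))"
    by (subst plus_emeasure[symmetric]) (auto simp: flip simp del: vimage_Int)
  also have "(A - {l..h}) \<union> (A \<inter> {l..h}) = A"
    by auto
  finally show ?thesis .
qed

text \<open>Since \<open>C\<close> contains the reflected interval, it is invariant under
  \<open>reflect l h\<close>; conditioning Lebesgue measure on \<open>C\<close> thus keeps its
  invariance.\<close>

lemma distr_uniform_reflect:
  assumes "{l..h} \<subseteq> C" and C [measurable]: "C \<in> sets borel"
  shows "distr (uniform_measure lborel C) borel (reflect l h) = uniform_measure lborel C"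
proof (rule measure_eqI)
  fix A :: "real set"
  assume "A \<in> sets (distr (uniform_measure lborel C) borel (reflect l h))"
  then have A [measurable]: "A \<in> sets borel"
    by simp
  have "C \<inter> reflect l h -` A = reflect l h -` (C \<inter> A)"
  proof -
    have "reflect l h u \<in> C \<longleftrightarrow> u \<in> C" for u
    proof (cases "u \<in> {l..h}")
      case True
      then have "u \<in> C" "l + h - u \<in> C"
        using assms(1) by (auto intro!: subsetD[OF assms(1)])
      then show ?thesis
        using True by (simp add: reflect_def)
    qed (auto simp: reflect_def)
    then show ?thesis
      by auto
  qed
  moreover have "reflect l h -` A \<in> sets borel"
    by (rule measurable_sets_borel[of _ borel]) auto
  ultimately show "emeasure (distr (uniform_measure lborel C) borel (reflect l h)) A =
      emeasure (uniform_measure lborel C) A"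
    by (simp add: emeasure_distr emeasure_lborel_vimage_reflect del: vimage_Int)
qed simp

text \<open>
  At each point the values of the mixture on \<open>V \<in> B\<close> and on \<open>V \<notin> B\<close> are \<open>U\<close> and
  \<open>R U\<close> in some order, so the choice of the switching set \<open>S\<close> does not affect the law.
\<close>

lemma (in prob_space) distr_fair_mixture:
  assumes UV: "indep_var borel U borel V"
    and [measurable]: "S \<in> sets borel" "B \<in> sets borel" "R \<in> borel_measurable borel"
    and half: "prob (V -` B \<inter> space M) = 1 / 2"
    and R: "distr M borel (\<lambda>\<omega>. R (U \<omega>)) = distr M borel U"
  shows "distr M borel (\<lambda>\<omega>. if V \<omega> \<in> B \<longleftrightarrow> U \<omega> \<in> S then U \<omega> else R (U \<omega>)) =
    distr M borel (U :: 'a \<Rightarrow> real)" (is "distr M borel ?W = _")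
proof (rule measure_eqI)
  have U [measurable]: "random_variable borel U" and V [measurable]: "random_variable borel V"
    using UV by (auto dest: indep_var_rv1 indep_var_rv2)
  fix A :: "real set"
  assume "A \<in> sets (distr M borel ?W)"
  then have A [measurable]: "A \<in> sets borel"
    by simp
  \<comment> \<open>By independence, each outcome of the fair coin \<open>V \<in> B\<close> halves
    the probability of any event about \<open>U\<close>.\<close>
  have V_split: "prob {\<omega> \<in> space M. V \<omega> \<in> B \<and> U \<omega> \<in> T} = prob {\<omega> \<in> space M. U \<omega> \<in> T} / 2"
      "prob {\<omega> \<in> space M. V \<omega> \<notin> B \<and> U \<omega> \<in> T} = prob {\<omega> \<in> space M. U \<omega> \<in> T} / 2"
    if T [measurable]: "T \<in> sets borel" for T
  proof -
    have "prob {\<omega> \<in> space M. V \<omega> \<in> B \<and> U \<omega> \<in> T} =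
        prob ((\<lambda>\<omega>. (U \<omega>, V \<omega>)) -` (T \<times> B) \<inter> space M)"
      by (intro arg_cong[where f = prob]) auto
    also have "\<dots> = prob (U -` T \<inter> space M) * (1 / 2)"
      using indep_varD[OF UV, of T B] by (simp add: half)
    also have "U -` T \<inter> space M = {\<omega> \<in> space M. U \<omega> \<in> T}"
      by auto
    finally show 1: "prob {\<omega> \<in> space M. V \<omega> \<in> B \<and> U \<omega> \<in> T} = prob {\<omega> \<in> space M. U \<omega> \<in> T} / 2"
      by simp
    have "prob {\<omega> \<in> space M. U \<omega> \<in> T} =
        prob {\<omega> \<in> space M. V \<omega> \<in> B \<and> U \<omega> \<in> T} + prob {\<omega> \<in> space M. V \<omega> \<notin> B \<and> U \<omega> \<in> T}"
      by (subst finite_measure_Union[symmetric]) (auto intro!: arg_cong[where f = prob])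
    with 1 show "prob {\<omega> \<in> space M. V \<omega> \<notin> B \<and> U \<omega> \<in> T} = prob {\<omega> \<in> space M. U \<omega> \<in> T} / 2"
      by simp
  qed
  define A' where "A' = R -` A"
  have A' [measurable]: "A' \<in> sets borel"
    unfolding A'_def by (rule measurable_sets_borel[of _ borel]) auto
  have split: "prob {\<omega> \<in> space M. Q \<omega>} = prob {\<omega> \<in> space M. Q \<omega> \<and> N \<omega>} + prob {\<omega> \<in> space M. Q \<omega> \<and> \<not> N \<omega>}"
    if [measurable]: "Measurable.pred M Q" "Measurable.pred M N" for Q N
    by (subst finite_measure_Union[symmetric]) (auto intro!: arg_cong[where f = prob])
  \<comment> \<open>On \<open>V \<in> B\<close> the mixture is \<open>U\<close> on \<open>S\<close>
    and \<open>R U\<close> off \<open>S\<close>; on \<open>V \<notin> B\<close> the roles are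
    exchanged. The four pieces then regroup into the events \<open>U \<in> A\<close> and
    \<open>R U \<in> A\<close>, and \<open>S\<close> disappears.\<close>
  have "prob {\<omega> \<in> space M. ?W \<omega> \<in> A} =
      prob {\<omega> \<in> space M. V \<omega> \<in> B \<and> U \<omega> \<in> S \<inter> A \<union> (A' - S)} +
      prob {\<omega> \<in> space M. V \<omega> \<notin> B \<and> U \<omega> \<in> (A - S) \<union> (A' \<inter> S)}"
    by (subst split[of _ "\<lambda>\<omega>. V \<omega> \<in> B"])
      (auto simp: A'_def intro!: arg_cong2[where f = "(+)"] arg_cong[where f = prob])
  also have "\<dots> = (prob {\<omega> \<in> space M. U \<omega> \<in> S \<inter> A \<union> (A' - S)} +
      prob {\<omega> \<in> space M. U \<omega> \<in> (A - S) \<union> (A' \<inter> S)}) / 2"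
    using V_split(1)[of "S \<inter> A \<union> (A' - S)"] V_split(2)[of "(A - S) \<union> (A' \<inter> S)"] by simp
  also have "\<dots> = (prob {\<omega> \<in> space M. U \<omega> \<in> A} + prob {\<omega> \<in> space M. U \<omega> \<in> A'}) / 2"
  proof -
    have 1: "prob {\<omega> \<in> space M. U \<omega> \<in> S \<inter> A \<union> (A' - S)} =
        prob {\<omega> \<in> space M. U \<omega> \<in> A \<and> U \<omega> \<in> S} + prob {\<omega> \<in> space M. U \<omega> \<in> A' \<and> U \<omega> \<notin> S}"
      by (subst split[of _ "\<lambda>\<omega>. U \<omega> \<in> S"])
        (auto intro!: arg_cong2[where f = "(+)"] arg_cong[where f = prob])
    have 2: "prob {\<omega> \<in> space M. U \<omega> \<in> (A - S) \<union> (A' \<inter> S)} =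
        prob {\<omega> \<in> space M. U \<omega> \<in> A' \<and> U \<omega> \<in> S} + prob {\<omega> \<in> space M. U \<omega> \<in> A \<and> U \<omega> \<notin> S}"
      by (subst split[of _ "\<lambda>\<omega>. U \<omega> \<in> S"])
        (auto intro!: arg_cong2[where f = "(+)"] arg_cong[where f = prob])
    show ?thesis
      unfolding 1 2
      using split[of "\<lambda>\<omega>. U \<omega> \<in> A" "\<lambda>\<omega>. U \<omega> \<in> S"] split[of "\<lambda>\<omega>. U \<omega> \<in> A'" "\<lambda>\<omega>. U \<omega> \<in> S"]
      by simp
  qed
  also have "prob {\<omega> \<in> space M. U \<omega> \<in> A'} = prob {\<omega> \<in> space M. U \<omega> \<in> A}"
  proof -
    have "measure (distr M borel (\<lambda>\<omega>. R (U \<omega>))) A = measure (distr M borel U) A"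
      by (simp only: R)
    then show ?thesis
      by (simp add: measure_distr A'_def vimage_def Int_def conj_commute)
  qed
  finally show "emeasure (distr M borel ?W) A = emeasure (distr M borel U) A"
    by (simp add: emeasure_distr emeasure_eq_measure vimage_def Int_def conj_commute)
qed simp

text \<open>The fair mixture is applied to the coin \<open>V > 1 / 2\<close> and a reflection inside
  the unit interval. Only almost sure equality is asked of \<open>W\<close>, because the explicit
  formulas may differ from \<open>reflect\<close> where \<open>U\<close> leaves that
  interval.\<close>

lemma has_cdf_fair_reflection:
  assumes P: "prob_space P" and UV: "prob_space.indep_var P borel U borel V"
    and U: "has_cdf P U (uniform_cdf 0 1)" and V: "has_cdf P V (uniform_cdf 0 1)"
    and "0 \<le> l" "h \<le> 1"
    and S [measurable]: "S \<in> sets borel" and W: "W \<in> borel_measurable P"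
    and AE: "AE \<omega> in P. W \<omega> = (if V \<omega> > 1 / 2 \<longleftrightarrow> U \<omega> \<in> S then U \<omega> else reflect l h (U \<omega>))"
  shows "has_cdf P W (uniform_cdf 0 1)"
proof -
  interpret prob_space P
    by (rule P)
  have [measurable]: "U \<in> borel_measurable P" "V \<in> borel_measurable P"
    using U V by (auto simp: has_cdf_def)
  have "distr P borel W = distr P borel (\<lambda>\<omega>. if V \<omega> \<in> {1/2<..} \<longleftrightarrow> U \<omega> \<in> S then U \<omega> else reflect l h (U \<omega>))"
    using W AE by (intro distr_cong_AE) auto
  also have "\<dots> = distr P borel U"
  proof (rule distr_fair_mixture[OF UV S])
    have "measure (distr P borel V) {1/2<..} = measure lborel ({0..1} \<inter> {1/2::real<..})"
      unfolding distr_uniform[OF P V, simplified] by simp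
    also have "{0..1} \<inter> {1/2<..} = {1/2<..1::real}"
      by auto
    finally show "prob (V -` {1/2<..} \<inter> space P) = 1 / 2"
      by (simp add: measure_distr)
    have "distr P borel (\<lambda>\<omega>. reflect l h (U \<omega>)) = distr (distr P borel U) borel (reflect l h)"
      by (subst distr_distr) (auto simp: comp_def)
    also have "\<dots> = distr P borel U"
      unfolding distr_uniform[OF P U, simplified] using assms by (intro distr_uniform_reflect) auto
    finally show "distr P borel (\<lambda>\<omega>. reflect l h (U \<omega>)) = distr P borel U" .
  qed auto
  finally show ?thesis
    using U W by (simp add: has_cdf_def)
qed

section \<open>The coupling common to both extremal problems\<close>

lemma integrable_abs_power_uniform:
  assumes "prob_space P" "has_cdf P X (uniform_cdf a b)" "a < b"
  shows "integrable P (\<lambda>\<omega>. \<bar>X \<omega>\<bar> ^ d)"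
proof -
  interpret prob_space P
    by (rule assms(1))
  have [measurable]: "X \<in> borel_measurable P"
    using assms by (simp add: has_cdf_def)
  have "AE \<omega> in P. norm (\<bar>X \<omega>\<bar> ^ d) \<le> max \<bar>a\<bar> \<bar>b\<bar> ^ d"
    using AE_uniform[OF assms]
  proof eventually_elim
    case (elim \<omega>)
    then have "\<bar>X \<omega>\<bar> \<le> max \<bar>a\<bar> \<bar>b\<bar>"
      by linarith
    then show ?case
      by (simp add: power_mono power_abs)
  qed
  then show ?thesis
    by (intro integrable_const_bound) auto
qed

text \<open>The condition on \<open>l + h\<close> says that replacing \<open>u\<close> by
  \<open>l + h - u\<close> negates the affine quantile \<open>a + (b - a) * u\<close>. Given
  \<open>U\<close> in \<open>{l..h}\<close>, the last two coordinates are flipped together or not at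
  all on \<open>S\<close>, and exactly one of them is flipped off \<open>S\<close>.\<close>

context
  fixes P :: "'w measure" and U V :: "'w \<Rightarrow> real" and W :: "nat \<Rightarrow> 'w \<Rightarrow> real"
    and F :: "nat \<Rightarrow> real \<Rightarrow> real" and a b l h :: real and d :: nat and S :: "real set"
  assumes P: "prob_space P" and UV: "prob_space.indep_var P borel U borel V"
    and U: "has_cdf P U (uniform_cdf 0 1)" and V: "has_cdf P V (uniform_cdf 0 1)"
    and ab: "a < b" and lh: "0 \<le> l" "h \<le> 1" "a + (b - a) * (l + h) = - a"
    and S: "S \<in> sets borel" and d: "3 \<le> d"
    and F: "\<And>i. i \<in> {1..d} \<Longrightarrow> F i = uniform_cdf a b"
    and Wm: "\<And>i. W i \<in> borel_measurable P"
    and W0: "\<And>i. i \<le> d - 2 \<Longrightarrow> W i = U"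
    and W1: "AE \<omega> in P. W (d - 1) \<omega> = (if V \<omega> > 1 / 2 then U \<omega> else reflect l h (U \<omega>))"
    and W2: "AE \<omega> in P. W d \<omega> =
      (if V \<omega> > 1 / 2 \<longleftrightarrow> U \<omega> \<in> S then U \<omega> else reflect l h (U \<omega>))"
begin

lemma has_cdf_coupling:
  assumes i: "i \<in> {1..d}"
  shows "has_cdf P (W i) (uniform_cdf 0 1)"
proof -
  consider "i \<le> d - 2" | "i = d - 1" | "i = d"
    using i by force
  then show ?thesis
  proof cases
    case 1
    then show ?thesis
      using U W0 by simp
  next
    case 2
    then show ?thesis
      \<comment> \<open>Coordinate \<open>d - 1\<close> follows the coin alone, which is the mixture
        with switching set \<open>UNIV\<close>.\<close>
      using has_cdf_fair_reflection[OF P UV U V lh(1,2), of UNIV] Wm W1 by simp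
  next
    case 3
    then show ?thesis
      using has_cdf_fair_reflection[OF P UV U V lh(1,2) S] Wm W2 by simp
  qed
qed

text \<open>Two sign changes cancel and one remains visible, so the product depends on
  \<open>U\<close> alone and the coin drops out.\<close>

lemma AE_coupling_prod:
  "AE \<omega> in P. (\<Prod>i\<in>{1..d}. quantile (F i) (W i \<omega>)) =
    (if U \<omega> \<in> {l..h} - S then - ((a + (b - a) * U \<omega>) ^ d) else (a + (b - a) * U \<omega>) ^ d)"
proof -
  have "AE \<omega> in P. \<forall>i\<in>{1..d}. quantile (F i) (W i \<omega>) = a + (b - a) * W i \<omega>"
    using AE_quantile_uniform[OF P has_cdf_coupling ab] F by (intro AE_finite_allI) auto
  then show ?thesis
    using W1 W2
  proof eventually_elim
    case (elim \<omega>)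
    define n where "n = d - 2"
    have n: "d = Suc (Suc n)"
      using d by (simp add: n_def)
    let ?z = "\<lambda>u. a + (b - a) * u"
    have refl: "?z (reflect l h u) = (if u \<in> {l..h} then - ?z u else ?z u)" for u
      using lh(3) by (simp add: reflect_def algebra_simps)
    have "(\<Prod>i\<in>{1..d}. quantile (F i) (W i \<omega>)) = (\<Prod>i\<in>{1..d}. ?z (W i \<omega>))"
      using elim(1) by (intro prod.cong) auto
    also have "\<dots> = (\<Prod>i\<in>{1..n}. ?z (W i \<omega>)) * ?z (W (d - 1) \<omega>) * ?z (W d \<omega>)"
      by (simp add: n)
    also have "(\<Prod>i\<in>{1..n}. ?z (W i \<omega>)) = ?z (U \<omega>) ^ n"
      using W0 by (simp add: n)
    also have "?z (U \<omega>) ^ n * ?z (W (d - 1) \<omega>) * ?z (W d \<omega>) =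
        (if U \<omega> \<in> {l..h} - S then - (?z (U \<omega>) ^ d) else ?z (U \<omega>) ^ d)"
      unfolding elim(2,3) if_distrib[of ?z] refl
      by (cases "U \<omega> \<in> {l..h}"; cases "U \<omega> \<in> S"; cases "V \<omega> > 1 / 2")
        (simp_all only: Diff_iff if_True if_False simp_thms power_Suc mult_minus_left mult_minus_right
          minus_minus mult_ac n)
    finally show ?case .
  qed
qed

text \<open>The factor \<open>s\<close> is the desired sign of the product. The hypothesis is purely
  deterministic, and levels in \<open>0 < u \<le> 1\<close> suffice because \<open>U\<close> lies
  there almost surely.\<close>

lemma
  assumes sgn: "\<And>u. 0 < u \<Longrightarrow> u \<le> 1 \<Longrightarrow>
    s * (if u \<in> {l..h} - S then - ((a + (b - a) * u) ^ d) else (a + (b - a) * u) ^ d) =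
    \<bar>a + (b - a) * u\<bar> ^ d"
  shows attains_sup_coupling: "s = 1 \<Longrightarrow> attains_sup P d F (\<lambda>i \<omega>. quantile (F i) (W i \<omega>))"
    and attains_inf_coupling: "s = - 1 \<Longrightarrow> attains_inf P d F (\<lambda>i \<omega>. quantile (F i) (W i \<omega>))"
proof -
  have X: "has_cdf P (\<lambda>\<omega>. quantile (F i) (W i \<omega>)) (uniform_cdf a b)" if "i \<in> {1..d}" for i
    using has_cdf_quantile_uniform[OF P has_cdf_coupling[OF that] ab] F[OF that] by simp
  have int: "integrable P (\<lambda>\<omega>. \<bar>quantile (F 1) (W 1 \<omega>)\<bar> ^ d)"
    using d by (intro integrable_abs_power_uniform[OF P X ab]) auto
  have "AE \<omega> in P. quantile (F 1) (W 1 \<omega>) = a + (b - a) * U \<omega>"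
    using AE_quantile_uniform[OF P U ab] F[of 1] W0[of 1] d by simp
  then have AE: "AE \<omega> in P. s * (\<Prod>i\<in>{1..d}. quantile (F i) (W i \<omega>)) =
      \<bar>quantile (F 1) (W 1 \<omega>)\<bar> ^ d"
    using AE_coupling_prod AE_uniform[OF P U zero_less_one]
    by eventually_elim (simp only: sgn)
  have d0: "0 < d"
    using d by simp
  show "attains_sup P d F (\<lambda>i \<omega>. quantile (F i) (W i \<omega>))" if "s = 1"
    using AE that by (intro attains_supI_prod_eq_abs_power[where G = "uniform_cdf a b", OF P d0 F] X int) simp_all
  have "AE \<omega> in P. (\<Prod>i\<in>{1..d}. quantile (F i) (W i \<omega>)) = - (\<bar>quantile (F 1) (W 1 \<omega>)\<bar> ^ d)"
    if "s = - 1"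
    using AE unfolding that by eventually_elim linarith
  then show "attains_inf P d F (\<lambda>i \<omega>. quantile (F i) (W i \<omega>))" if "s = - 1"
    using that
    by (intro attains_infI_prod_eq_minus_abs_power[where G = "uniform_cdf a b", OF P d0 F] X int)
qed

end

section \<open>The explicit couplings for the supremum and the infimum\<close>

theorem proposition3p3:
  fixes a b :: real and d :: nat and F :: "nat \<Rightarrow> real \<Rightarrow> real"
    and P :: "'w measure" and U V :: "'w \<Rightarrow> real"
  assumes "d \<ge> 2" and "odd d"
    and "a < 0" and "0 < b"
    and "\<forall>i\<in>{1..d}. F i = uniform_cdf a b"
    and "prob_space P"
    and "has_cdf P U (uniform_cdf 0 1)"
    and "has_cdf P V (uniform_cdf 0 1)"
    and "prob_space.indep_var P borel U borel V"
  shows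
    "(\<bar>a\<bar> < b \<longrightarrow>
       (let c = (-2 * a) / (b - a);
            W = (\<lambda>i \<omega>.
              let u = U \<omega>;
                  J = of_bool (V \<omega> > 1/2);
                  I = of_bool (u > c);
                  K = of_bool (u > c/2)
              in if i \<le> d - 2 then u
                 else if i = d - 1 then
                   (1 - I) * (K * J * u + K * (1 - J) * (c - u)
                     + (1 - K) * J * u + (1 - K) * (1 - J) * (c - u)) + I * u
                 else
                   (1 - I) * (K * J * u + K * (1 - J) * (c - u)
                     + (1 - K) * J * (c - u) + (1 - K) * (1 - J) * u) + I * u)
        in attains_sup P d F (\<lambda>i \<omega>. quantile (F i) (W i \<omega>))))
     \<and>
     (\<bar>a\<bar> > b \<longrightarrow>
       (let c = (- b - a) / (b - a);
            W = (\<lambda>i \<omega>.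
              let u = U \<omega>;
                  J = of_bool (V \<omega> > 1/2);
                  I = of_bool (u < c);
                  K = of_bool (u > (1 + c)/2)
              in if i \<le> d - 2 then u
                 else if i = d - 1 then
                   (1 - I) * (K * J * u + K * (1 - J) * (1 + c - u)
                     + (1 - K) * J * u + (1 - K) * (1 - J) * (1 + c - u)) + I * u
                 else
                   (1 - I) * (K * J * (1 + c - u) + K * (1 - J) * u
                     + (1 - K) * J * u + (1 - K) * (1 - J) * (1 + c - u)) + I * u)
        in attains_inf P d F (\<lambda>i \<omega>. quantile (F i) (W i \<omega>))))"
proof -
  \<comment> \<open>Matching against the goal names the constants and vectors of both halves, so the
    long formulas are not repeated.\<close>
  let "(_ \<longrightarrow> Let ?c1 (\<lambda>c. Let (?W1 c) (\<lambda>W. attains_sup P d F (\<lambda>i \<omega>. quantile (F i) (W i \<omega>))))) \<and>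
      (_ \<longrightarrow> Let ?c2 (\<lambda>c. Let (?W2 c) (\<lambda>W. attains_inf P d F (\<lambda>i \<omega>. quantile (F i) (W i \<omega>)))))"
    = ?thesis
  \<comment> \<open>Oddness raises the bound to \<open>3 \<le> d\<close>, so index 1 belongs to the
    block of coordinates equal to \<open>U\<close>.\<close>
  have "d \<noteq> 2"
    using \<open>odd d\<close> by auto
  then have ab: "a < b" and d: "3 \<le> d"
    using assms by simp_all
  have F: "F i = uniform_cdf a b" if "i \<in> {1..d}" for i
    using assms that by simp
  have [measurable]: "U \<in> borel_measurable P" "V \<in> borel_measurable P"
    using assms by (auto simp: has_cdf_def)
  note U01 = AE_uniform[OF \<open>prob_space P\<close> \<open>has_cdf P U _\<close> zero_less_one]
  note coupling = \<open>prob_space P\<close> \<open>prob_space.indep_var P borel U borel V\<close>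
    \<open>has_cdf P U _\<close> \<open>has_cdf P V _\<close> ab
  have abs_odd: "\<bar>z\<bar> ^ d = (if z < 0 then - (z ^ d) else z ^ d)" for z :: real
    using \<open>odd d\<close> by (simp add: abs_if)
  have "attains_sup P d F (\<lambda>i \<omega>. quantile (F i) (W i \<omega>))"
    if "\<bar>a\<bar> < b" and c: "c = ?c1" and W: "W = ?W1 c" for c W
  proof -
    have bac: "(b - a) * c = - 2 * a"
      using ab by (simp add: c)
    \<comment> \<open>The bound \<open>c < 1\<close> is exactly \<open>\<bar>a\<bar> < b\<close>:
      the reflected interval \<open>{0..c}\<close> fits into the unit interval.\<close>
    have c01: "0 < c" "c < 1"
      unfolding c using \<open>a < 0\<close> \<open>0 < b\<close> that(1)
      by (auto intro!: divide_pos_pos simp: pos_divide_less_eq pos_less_divide_eq)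
    \<comment> \<open>The midpoint \<open>c / 2\<close> is the level at which the quantile vanishes.
      Negative values, of negative odd power, occur just below it, and there the sign must be
      changed.\<close>
    have pos: "c / 2 < u \<longleftrightarrow> 0 < a + (b - a) * u" for u
      using ab bac mult_less_cancel_left_pos[of "b - a" "c / 2" u] by simp linarith
    have sgn: "1 * (if u \<in> {0..c} - {c / 2<..} then - ((a + (b - a) * u) ^ d)
        else (a + (b - a) * u) ^ d) = \<bar>a + (b - a) * u\<bar> ^ d" if "0 < u" "u \<le> 1" for u
      using pos[of u] that c01 d by (auto simp: abs_odd not_less)
    show ?thesis
    \<comment> \<open>The last coordinate equals \<open>U\<close> when \<open>J = K\<close>, so the
      switching set is the event \<open>K = 1\<close> in terms of the level.\<close>
    proof (rule attains_sup_coupling[OF coupling, of 0 c "{c / 2<..}", OF _ _ _ _ d F _ _ _ _ sgn])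
      show "W i \<in> borel_measurable P" for i
        unfolding W Let_def by measurable
      show "AE \<omega> in P. W (d - 1) \<omega> = (if V \<omega> > 1 / 2 then U \<omega> else reflect 0 c (U \<omega>))"
        \<comment> \<open>The formula tests only \<open>U \<le> c\<close>, while
          \<open>reflect\<close> also requires \<open>0 \<le> U\<close>; the almost sure bound
          closes this gap.\<close>
        using U01 by eventually_elim (use d in \<open>auto simp: W Let_def reflect_def\<close>)
      show "AE \<omega> in P. W d \<omega> =
          (if V \<omega> > 1 / 2 \<longleftrightarrow> U \<omega> \<in> {c / 2<..} then U \<omega> else reflect 0 c (U \<omega>))"
        using U01 by eventually_elim (use d c01 in \<open>auto simp: W Let_def reflect_def\<close>)
    qed (use c01 bac in \<open>auto simp: W\<close>)
  qed
  moreover have "attains_inf P d F (\<lambda>i \<omega>. quantile (F i) (W i \<omega>))"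
    if "\<bar>a\<bar> > b" and c: "c = ?c2" and W: "W = ?W2 c" for c W
  proof -
    have bac: "(b - a) * c = - b - a"
      using ab by (simp add: c)
    \<comment> \<open>Now \<open>0 < c\<close> is exactly \<open>\<bar>a\<bar> > b\<close>, and the
      reflected interval is \<open>{c..1}\<close>, again centred at the zero of the
      quantile.\<close>
    have c01: "0 < c" "c < 1"
      unfolding c using \<open>a < 0\<close> \<open>0 < b\<close> that(1)
      by (auto intro!: divide_pos_pos simp: pos_divide_less_eq pos_less_divide_eq)
    have pos: "u \<le> (1 + c) / 2 \<longleftrightarrow> a + (b - a) * u \<le> 0" for u
      using ab bac mult_le_cancel_left_pos[of "b - a" u "(1 + c) / 2"] by (simp add: distrib_left) linarith
    \<comment> \<open>Here the sign is changed above the midpoint, where the quantile is positive,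
      which makes the product nonpositive throughout.\<close>
    have sgn: "(- 1) * (if u \<in> {c..1} - {..(1 + c) / 2} then - ((a + (b - a) * u) ^ d)
        else (a + (b - a) * u) ^ d) = \<bar>a + (b - a) * u\<bar> ^ d" if "0 < u" "u \<le> 1" for u
      using pos[of u] that c01 d by (auto simp: abs_odd not_less)
    show ?thesis
    \<comment> \<open>In this half the last coordinate equals \<open>U\<close> when \<open>J\<close>
      and \<open>K\<close> differ, so the switching set is the complement of
      \<open>K = 1\<close>.\<close>
    proof (rule attains_inf_coupling[OF coupling, of c 1 "{..(1 + c) / 2}", OF _ _ _ _ d F _ _ _ _ sgn])
      show "W i \<in> borel_measurable P" for i
        unfolding W Let_def by measurable
      show "AE \<omega> in P. W (d - 1) \<omega> = (if V \<omega> > 1 / 2 then U \<omega> else reflect c 1 (U \<omega>))"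
        \<comment> \<open>This time the gap between formula and \<open>reflect\<close> is above 1,
          and \<open>U \<le> 1\<close> closes it.\<close>
        using U01 by eventually_elim (use d in \<open>auto simp: W Let_def reflect_def\<close>)
      show "AE \<omega> in P. W d \<omega> =
          (if V \<omega> > 1 / 2 \<longleftrightarrow> U \<omega> \<in> {..(1 + c) / 2} then U \<omega> else reflect c 1 (U \<omega>))"
        using U01 by eventually_elim (use d c01 in \<open>auto simp: W Let_def reflect_def\<close>)
    qed (use c01 bac in \<open>auto simp: W algebra_simps\<close>)
  qed
  ultimately show ?thesis
    unfolding Let_def by blast
qed

end
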